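(* Assume $L$ has Gram matrix $G=\begin{pmatrix}0&1\\1&0\end{pmatrix}$ (notation in the context). Then $$\beta_{\mathfrak{p}}^{+}(X;X)=\begin{cases}1-N(\mathfrak{p})^{-1},&\text{if }\mathfrak{t}_m=0,\\ N(\mathfrak{p})^{-\mathfrak{t}_m},&\text{if }\mathfrak{t}_m\geq1.\end{cases}$$
   Context: $K$ is a finite extension of $\mathbb{Q}_p$ with ring of integers $\mathcal{O}$, maximal ideal $\mathfrak{p}$, uniformizer $\pi$, $N(\mathfrak{p})=|\mathcal{O}/\mathfrak{p}|$. $L$ is a lattice in a $2$-dimensional quadratic space over $K$ with basis $\{e_1,e_2\}$ and Gram matrix $G=\begin{pmatrix}0&1\\1&0\end{pmatrix}$. $X=L+\nu$ with $\nu=(s_1e_1+s_2e_2)/\pi^{\mathfrak{t}_m}$, $\mathfrak{t}_m\in\mathbb{Z}$, $s_1,s_2\in\mathcal{O}$, at least one a unit. Put $\mathfrak{t}_L=0$. For $t\geq\max(\mathfrak{t}_m,\mathfrak{t}_L+1)$, $O^{+}(X,\mathfrak{p}^t)=\{M\in\mathrm{GL}_2(\mathcal{O}/\mathfrak{p}^t): M^TGM\equiv G,\ \det M\equiv1\pmod{\mathfrak{p}^{t+\mathfrak{t}_L}},\ M\binom{s_1}{s_2}\equiv\binom{s_1}{s_2}\pmod{\mathfrak{p}^{\mathfrak{t}_m}}\}$, and $\beta_{\mathfrak{p}}^{+}(X;X)=\lim_{t\to\infty}|O^{+}(X,\mathfrak{p}^t)|/N(\mathfrak{p})^t$.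
   Formalization: The formal theorem assumes p is odd. For p = 2 the formula is false with the stated definition: the density is |O/2O|^2 times the stated value (e.g. K = Q_2, t_m = 0 gives 2 instead of 1/2). *)

theory Defs
  imports "HOL-Analysis.Analysis" "HOL-Computational_Algebra.Primes"
begin

section \<open>Finite extensions of the p-adic numbers\<close>

definition padic_abs :: "nat \<Rightarrow> rat \<Rightarrow> real" where
  "padic_abs p q =
     (if q = 0 then 0
      else case quotient_of q of (a, b) \<Rightarrow>
        real p powi (int (multiplicity (int p) b) - int (multiplicity (int p) a)))"

locale nonarch_abs =
  fixes v :: "'k::field \<Rightarrow> real"
  assumes nonneg: "0 \<le> v x"
    and eq_0_iff: "v x = 0 \<longleftrightarrow> x = 0"
    and mult: "v (x * y) = v x * v y"
    and ultrametric: "v (x + y) \<le> max (v x) (v y)"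

text \<open>
  A type cannot depend on the prime \<open>p\<close>, so the field of p-adic numbers is given by what
  defines it up to unique isomorphism: it is a completion of the rationals with respect to
  the p-adic absolute value.
\<close>

locale padic_numbers = nonarch_abs w
  for p :: nat and w :: "'q::field_char_0 \<Rightarrow> real" +
  assumes prime_p: "prime p"
    and abs_of_rat: "w (of_rat r) = padic_abs p r"
    and complete: "Metric_space.mcomplete UNIV (\<lambda>x y. w (x - y))"
    and dense: "\<epsilon> > 0 \<Longrightarrow> \<exists>r. w (x - of_rat r) < \<epsilon>"

text \<open>
  A field \<open>'k\<close> of finite degree over the p-adic numbers \<open>'q\<close>, embedded by \<open>\<iota>\<close>. The absolute
  value \<open>v\<close> on \<open>'k\<close> is the (unique) one that extends the p-adic absolute value \<open>w\<close>.
\<close>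

locale padic_extension = Qp: padic_numbers p w + nonarch_abs v
  for p :: nat and w :: "'q::field_char_0 \<Rightarrow> real"
    and \<iota> :: "'q \<Rightarrow> 'k::field" and v :: "'k \<Rightarrow> real" +
  assumes embed_1: "\<iota> 1 = 1"
    and embed_add: "\<iota> (a + b) = \<iota> a + \<iota> b"
    and embed_mult: "\<iota> (a * b) = \<iota> a * \<iota> b"
    and finite_degree: "\<exists>B. finite_dimensional_vector_space (\<lambda>a x. \<iota> a * x) B"
    and abs_embed: "v (\<iota> a) = w a"

definition int_ring :: "('k::field \<Rightarrow> real) \<Rightarrow> 'k set" where
  "int_ring v = {x. v x \<le> 1}"

definition max_ideal :: "('k::field \<Rightarrow> real) \<Rightarrow> 'k set" where
  "max_ideal v = {x. v x < 1}"

definition uniformizer :: "('k::field \<Rightarrow> real) \<Rightarrow> 'k \<Rightarrow> bool" where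
  "uniformizer v \<pi> \<longleftrightarrow> max_ideal v = {\<pi> * x |x. x \<in> int_ring v}"

text \<open>The fractional ideal generated by \<open>\<pi>\<close> to the power \<open>k\<close>.\<close>

definition ideal_pow :: "('k::field \<Rightarrow> real) \<Rightarrow> 'k \<Rightarrow> int \<Rightarrow> 'k set" where
  "ideal_pow v \<pi> k = {\<pi> powi k * x |x. x \<in> int_ring v}"

definition residue_class :: "'k::field set \<Rightarrow> 'k \<Rightarrow> 'k set" where
  "residue_class I x = {y. y - x \<in> I}"

definition residue_norm :: "('k::field \<Rightarrow> real) \<Rightarrow> nat" where
  "residue_norm v = card (residue_class (max_ideal v) ` int_ring v)"

section \<open>Binary lattice cosets\<close>

locale quadratic_plane = vector_space smul
  for smul :: "'k::field \<Rightarrow> 'v::ab_group_add \<Rightarrow> 'v" +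
  fixes B :: "'v \<Rightarrow> 'v \<Rightarrow> 'k" and e\<^sub>1 e\<^sub>2 :: 'v
  assumes basis_distinct: "e\<^sub>1 \<noteq> e\<^sub>2"
    and basis_independent: "independent {e\<^sub>1, e\<^sub>2}"
    and basis_span: "span {e\<^sub>1, e\<^sub>2} = UNIV"
    and bilinear: "Vector_Spaces.linear smul (*) (B x)"
    and symmetric: "B x y = B y x"

definition gram :: "('v \<Rightarrow> 'v \<Rightarrow> 'k) \<Rightarrow> 'v \<Rightarrow> 'v \<Rightarrow> ('k::field)^2^2" where
  "gram B e\<^sub>1 e\<^sub>2 = vector [vector [B e\<^sub>1 e\<^sub>1, B e\<^sub>1 e\<^sub>2], vector [B e\<^sub>2 e\<^sub>1, B e\<^sub>2 e\<^sub>2]]"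

definition int_lattice ::
  "('k::field \<Rightarrow> real) \<Rightarrow> ('k \<Rightarrow> 'v::ab_group_add \<Rightarrow> 'v) \<Rightarrow> 'v \<Rightarrow> 'v \<Rightarrow> 'v set" where
  "int_lattice v smul e\<^sub>1 e\<^sub>2 = {smul x e\<^sub>1 + smul y e\<^sub>2 |x y. x \<in> int_ring v \<and> y \<in> int_ring v}"

text \<open>
  \<open>X = L + \<nu>\<close>, where \<open>\<nu> = (s\<^sub>1 e\<^sub>1 + s\<^sub>2 e\<^sub>2) / \<pi>\<^sup>m\<close> and \<open>s\<^sub>1\<close>, \<open>s\<^sub>2\<close> are integral and not both
  in the maximal ideal.
\<close>

definition lattice_coset ::
  "('k::field \<Rightarrow> real) \<Rightarrow> 'k \<Rightarrow> ('k \<Rightarrow> 'v::ab_group_add \<Rightarrow> 'v) \<Rightarrow> 'v \<Rightarrow> 'v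
    \<Rightarrow> 'k^2 \<Rightarrow> int \<Rightarrow> 'v set \<Rightarrow> bool" where
  "lattice_coset v \<pi> smul e\<^sub>1 e\<^sub>2 s m X \<longleftrightarrow>
     (\<forall>i. s$i \<in> int_ring v) \<and> (\<exists>i. s$i \<in> int_ring v - max_ideal v) \<and>
     (let \<nu> = smul (inverse (\<pi> powi m)) (smul (s$1) e\<^sub>1 + smul (s$2) e\<^sub>2)
      in X = {x + \<nu> |x. x \<in> int_lattice v smul e\<^sub>1 e\<^sub>2})"

section \<open>Matrices modulo powers of the maximal ideal\<close>

definition int_matrices :: "('k::field \<Rightarrow> real) \<Rightarrow> ('k^2^2) set" where
  "int_matrices v = {M. \<forall>i j. M$i$j \<in> int_ring v}"

definition vec_cong :: "'k::field set \<Rightarrow> 'k^2 \<Rightarrow> 'k^2 \<Rightarrow> bool" where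
  "vec_cong I x y \<longleftrightarrow> (\<forall>i. x$i - y$i \<in> I)"

definition mat_cong :: "'k::field set \<Rightarrow> 'k^2^2 \<Rightarrow> 'k^2^2 \<Rightarrow> bool" where
  "mat_cong I M N \<longleftrightarrow> (\<forall>i j. M$i$j - N$i$j \<in> I)"

definition mat_residue :: "'k::field set \<Rightarrow> 'k^2^2 \<Rightarrow> ('k set)^2^2" where
  "mat_residue I M = (\<chi> i j. residue_class I (M$i$j))"

text \<open>
  The integral matrices whose reduction modulo the \<open>t\<close>-th power of the maximal ideal is
  invertible over the residue ring.
\<close>

definition GL2_lifts :: "('k::field \<Rightarrow> real) \<Rightarrow> 'k \<Rightarrow> nat \<Rightarrow> ('k^2^2) set" where
  "GL2_lifts v \<pi> t = {M \<in> int_matrices v. \<exists>N \<in> int_matrices v.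
     mat_cong (ideal_pow v \<pi> (int t)) (M ** N) (mat 1) \<and>
     mat_cong (ideal_pow v \<pi> (int t)) (N ** M) (mat 1)}"

text \<open>
  A set of matrices over the residue ring modulo the \<open>t\<close>-th power of the maximal ideal; its
  elements are written as the reductions of integral matrices. It is used for
  \<open>t \<ge> max m (l + 1)\<close>, where \<open>l\<close> is the precision attached to the lattice. For \<open>l = 0\<close>, the
  value for the hyperbolic plane, the congruences do not depend on the choice of the
  integral matrix \<open>M\<close> in its class. Beware of residue characteristic 2: a congruence of Gram
  matrices then says less about the diagonal than a congruence of quadratic forms, which
  enlarges the set by a constant factor for all large \<open>t\<close>.
\<close>

definition O_plus ::
  "('k::field \<Rightarrow> real) \<Rightarrow> 'k \<Rightarrow> int \<Rightarrow> 'k^2^2 \<Rightarrow> 'k^2 \<Rightarrow> int \<Rightarrow> nat \<Rightarrow> (('k set)^2^2) set" where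
  "O_plus v \<pi> l G s m t =
     {mat_residue (ideal_pow v \<pi> (int t)) M |M. M \<in> GL2_lifts v \<pi> t \<and>
        mat_cong (ideal_pow v \<pi> (int t + l)) (transpose M ** G ** M) G \<and>
        det M - 1 \<in> ideal_pow v \<pi> (int t + l) \<and>
        vec_cong (ideal_pow v \<pi> m) (M *v s) s}"

text \<open>The limit that defines the local density exists and is equal to \<open>\<beta>\<close>.\<close>

definition has_beta_plus ::
  "('k::field \<Rightarrow> real) \<Rightarrow> 'k \<Rightarrow> int \<Rightarrow> 'k^2^2 \<Rightarrow> 'k^2 \<Rightarrow> int \<Rightarrow> real \<Rightarrow> bool" where
  "has_beta_plus v \<pi> l G s m \<beta> \<longleftrightarrow>
     (\<lambda>t. real (card (O_plus v \<pi> l G s m t)) / real (residue_norm v) ^ t) \<longlonglongrightarrow> \<beta>"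

end

theory Submission
  imports Defs
begin

text \<open>
  As 2 is a unit, the congruences force \<open>M\<close> to be diagonal modulo \<open>\<pi>\<^sup>t\<close>, with entries \<open>u\<close> and
  \<open>u\<inverse>\<close> for a unit \<open>u\<close>. Fixing a vector with a unit coordinate modulo \<open>\<pi>\<^sup>m\<close> then means
  \<open>u \<equiv> 1\<close> modulo \<open>\<pi>\<^sup>m\<close>. With \<open>q\<close> the order of the residue field, there are
  \<open>q\<^sup>t - q\<^sup>t\<^sup>-\<^sup>1\<close> such classes if \<open>m = 0\<close> and \<open>q\<^sup>t\<^sup>-\<^sup>m\<close> if \<open>m \<ge> 1\<close>. The residue field is finite because
  integers whose reductions are independent over the prime field are independent over the
  p-adic numbers, so that its degree over the prime field is bounded.
\<close>

text \<open>Sending \<open>f x\<close> to \<open>g x\<close> is well defined and injective because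
  both maps have the same fibres on \<open>A\<close>. The counts of residue classes below are
  thereby reduced to comparing congruences between representatives.\<close>

lemma card_image_cong_kernel:
  assumes "\<And>x y. x \<in> A \<Longrightarrow> y \<in> A \<Longrightarrow> f x = f y \<longleftrightarrow> g x = g y"
  shows "card (f ` A) = card (g ` A)"
proof -
  define h where "h = (\<lambda>z. g (SOME x. x \<in> A \<and> f x = z))"
  have h: "h (f x) = g x" if "x \<in> A" for x
  proof -
    have "\<exists>y. y \<in> A \<and> f y = f x" using that by blast
    from someI_ex[OF this] show ?thesis
      unfolding h_def using assms that by blast
  qed
  have "inj_on h (f ` A)"
    using h assms by (auto simp: inj_on_def)
  moreover have "h ` f ` A = g ` A"
    by (simp add: image_image h cong: image_cong)
  ultimately show ?thesis by (metis card_image)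
qed

section \<open>Non-archimedean absolute values\<close>

context nonarch_abs
begin

lemma zero [simp]: "v 0 = 0"
  by (simp add: eq_0_iff)

lemma pos: "x \<noteq> 0 \<Longrightarrow> 0 < v x"
  using nonneg[of x] eq_0_iff[of x] by linarith

lemma one [simp]: "v 1 = 1"
  using mult[of 1 1] eq_0_iff[of 1] by simp

lemma minus [simp]: "v (- x) = v x"
proof -
  have "v (- 1) * v (- 1) = 1" using mult[of "- 1" "- 1"] by simp
  then have "v (- 1) = 1" using nonneg[of "- 1"] by (simp add: square_eq_1_iff)
  then show ?thesis using mult[of "- 1" x] by simp
qed

lemma minus_commute: "v (x - y) = v (y - x)"
  using minus[of "x - y"] by simp

lemma inverse: "v (inverse x) = inverse (v x)"
proof (cases "x = 0")
  case False
  then have "v x * v (inverse x) = 1" using mult[of x "inverse x"] by simp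
  then show ?thesis by (metis inverse_unique)
qed simp

lemma divide: "v (x / y) = v x / v y"
  by (simp add: divide_inverse mult inverse)

lemma power: "v (x ^ n) = v x ^ n"
  by (induction n) (simp_all add: mult)

lemma add_le: "v x \<le> e \<Longrightarrow> v y \<le> e \<Longrightarrow> v (x + y) \<le> e"
  using ultrametric[of x y] by linarith

lemma add_less: "v x < e \<Longrightarrow> v y < e \<Longrightarrow> v (x + y) < e"
  using ultrametric[of x y] by linarith

lemma diff_le: "v x \<le> e \<Longrightarrow> v y \<le> e \<Longrightarrow> v (x - y) \<le> e"
  using add_le[of x e "- y"] by simp

lemma diff_less: "v x < e \<Longrightarrow> v y < e \<Longrightarrow> v (x - y) < e"
  using add_less[of x e "- y"] by simp

text \<open>Positivity of \<open>e\<close> covers the sum over an empty or infinite set, which is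
  0.\<close>

lemma sum_less:
  assumes "0 < e" "\<And>i. i \<in> A \<Longrightarrow> v (f i) < e"
  shows "v (\<Sum>i\<in>A. f i) < e"
  using assms(2) by (induction A rule: infinite_finite_induct) (simp_all add: assms(1) add_less)

lemma mult_le: "v x \<le> 1 \<Longrightarrow> v y \<le> e \<Longrightarrow> v (x * y) \<le> e"
  using mult_mono[of "v x" 1 "v y" e] nonneg[of x] nonneg[of y] by (simp add: mult)

text \<open>Units are stable under perturbation by the maximal ideal: if \<open>v x\<close> were
  below 1, the ultrametric inequality would make \<open>v y\<close> less than 1 too.\<close>

lemma eq_1_if_close:
  assumes "v (x - y) < 1" "v y = 1"
  shows "v x = 1"
proof (rule antisym)
  show "v x \<le> 1" using add_le[of "x - y" 1 y] assms by simp
  show "1 \<le> v x" using add_less[of x 1 "y - x"] assms minus_commute[of x y] by force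
qed

text \<open>The difference of the inverses is \<open>(y - x) / (x * y)\<close>, and dividing by
  units preserves the absolute value. Hence two units are congruent modulo a power of \<pi> exactly
  when their inverses are.\<close>

lemma inverse_close:
  assumes "v x = 1" "v y = 1"
  shows "v (inverse x - inverse y) = v (x - y)"
proof -
  have "x \<noteq> 0" "y \<noteq> 0" using assms by auto
  then have "inverse x - inverse y = (y - x) / (x * y)" by (simp add: field_simps)
  then show ?thesis using assms by (simp add: divide mult minus_commute)
qed

end

section \<open>Residue rings of a discrete valuation ring\<close>

text \<open>The condition that \<pi> is nonzero excludes the trivial absolute value, whose maximal
  ideal is zero and thus generated by 0.\<close>

locale discrete_abs = nonarch_abs v for v :: "'k::field \<Rightarrow> real" +
  fixes \<pi> :: 'k
  assumes uniformizer: "uniformizer v \<pi>"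
    and nonzero: "\<pi> \<noteq> 0"
begin

definition cls :: "nat \<Rightarrow> 'k \<Rightarrow> 'k set" where
  "cls n = residue_class (ideal_pow v \<pi> (int n))"

lemma uniformizer_pos: "0 < v \<pi>"
  by (rule pos[OF nonzero])

lemma uniformizer_less_1: "v \<pi> < 1"
proof -
  have "\<pi> * 1 \<in> max_ideal v"
    using uniformizer by (auto simp: uniformizer_def int_ring_def intro!: exI[of _ 1])
  then show ?thesis by (simp add: max_ideal_def)
qed

text \<open>Division by \<open>\<pi> ^ n\<close> turns membership into integrality. From here on,
  congruences modulo powers of \<pi> are handled as inequalities between absolute values.\<close>

lemma mem_ideal_pow: "x \<in> ideal_pow v \<pi> (int n) \<longleftrightarrow> v x \<le> v \<pi> ^ n"
proof -
  have "x = \<pi> ^ n * (x / \<pi> ^ n)" using nonzero by simp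
  then show ?thesis
    using uniformizer_pos nonzero
    by (auto simp: ideal_pow_def int_ring_def mult power divide divide_simps mult_left_le
             intro!: exI[of _ "x / \<pi> ^ n"])
qed

lemma max_ideal_eq: "max_ideal v = ideal_pow v \<pi> (int 1)"
  using uniformizer by (simp add: uniformizer_def ideal_pow_def)

text \<open>This is discreteness: since \<pi> generates the maximal ideal, no absolute value lies
  strictly between \<open>v \<pi>\<close> and 1.\<close>

lemma less_1_iff: "v x < 1 \<longleftrightarrow> v x \<le> v \<pi>"
  using max_ideal_eq mem_ideal_pow[of x 1] by (auto simp: max_ideal_def)

lemma cls_eq_iff: "cls n x = cls n y \<longleftrightarrow> v (x - y) \<le> v \<pi> ^ n"
proof
  have "x \<in> cls n x" using uniformizer_pos by (simp add: cls_def residue_class_def mem_ideal_pow)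
  moreover assume "cls n x = cls n y"
  ultimately have "x \<in> cls n y" by simp
  then show "v (x - y) \<le> v \<pi> ^ n" by (simp add: cls_def residue_class_def mem_ideal_pow)
next
  assume *: "v (x - y) \<le> v \<pi> ^ n"
  have "v (z - x) \<le> v \<pi> ^ n \<longleftrightarrow> v (z - y) \<le> v \<pi> ^ n" for z
    using add_le[of "z - x" _ "x - y"] diff_le[of "z - y" _ "x - y"] * by auto
  then show "cls n x = cls n y" by (simp add: cls_def residue_class_def mem_ideal_pow)
qed

lemma residue_norm_eq: "residue_norm v = card (cls 1 ` int_ring v)"
  by (simp only: residue_norm_def max_ideal_eq cls_def)

lemma residue_norm_pos:
  assumes "finite (cls 1 ` int_ring v)"
  shows "0 < residue_norm v"
proof -
  have "0 \<in> int_ring v" by (simp add: int_ring_def)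
  then show ?thesis using assms by (auto simp: residue_norm_eq card_gt_0_iff)
qed

text \<open>Induction by splitting off the lowest digit. With \<open>T\<close> a system of
  representatives of the residue field, each integer is congruent to some
  \<open>r + \<pi> * x\<close> with \<open>r\<close> in \<open>T\<close> and \<open>x\<close>
  integral, and its class modulo \<open>\<pi> ^ Suc n\<close> corresponds to the pair of
  \<open>r\<close> and the class of \<open>x\<close> modulo \<open>\<pi> ^ n\<close>.\<close>

lemma card_cls_int_ring: "card (cls n ` int_ring v) = residue_norm v ^ n"
proof (induction n)
  case 0
  have "cls 0 ` int_ring v = {cls 0 0}"
  proof -
    have "cls 0 x = cls 0 0" if "x \<in> int_ring v" for x
      using that by (simp add: cls_eq_iff int_ring_def)
    moreover have "0 \<in> int_ring v" by (simp add: int_ring_def)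
    ultimately show ?thesis by blast
  qed
  then show ?case by simp
next
  case (Suc n)
  obtain T where T: "T \<subseteq> int_ring v" "inj_on (cls 1) T" "cls 1 ` int_ring v = cls 1 ` T"
    using subset_image_inj[of "cls 1 ` int_ring v" "cls 1" "int_ring v"] by auto
  have cardT: "card T = residue_norm v"
    using T by (simp only: residue_norm_eq) (simp add: card_image)
  let ?f = "\<lambda>(r, x). cls (Suc n) (r + \<pi> * x)" and ?g = "\<lambda>(r, x). (r, cls n x)"
  have "?f ` (T \<times> int_ring v) = cls (Suc n) ` int_ring v"
  proof (intro equalityI subsetI)
    fix z assume "z \<in> ?f ` (T \<times> int_ring v)"
    then obtain r x where rx: "r \<in> T" "v x \<le> 1" "z = cls (Suc n) (r + \<pi> * x)"
      by (auto simp: int_ring_def)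
    then have "v r \<le> 1" using T(1) by (auto simp: int_ring_def)
    moreover have "v (\<pi> * x) \<le> 1"
      using uniformizer_less_1 rx(2) by (intro mult_le) simp_all
    ultimately have "r + \<pi> * x \<in> int_ring v" by (simp add: int_ring_def add_le)
    then show "z \<in> cls (Suc n) ` int_ring v" using rx by blast
  next
    fix z assume "z \<in> cls (Suc n) ` int_ring v"
    then obtain y where y: "y \<in> int_ring v" "z = cls (Suc n) y" by blast
    then obtain r where r: "r \<in> T" "cls 1 y = cls 1 r" using T(3) by blast
    then have "v (y - r) \<le> v \<pi>" by (simp only: cls_eq_iff) simp
    then have "(y - r) / \<pi> \<in> int_ring v"
      using uniformizer_pos by (simp add: int_ring_def divide)
    moreover have "r + \<pi> * ((y - r) / \<pi>) = y" using nonzero by simp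
    ultimately show "z \<in> ?f ` (T \<times> int_ring v)"
      using r(1) y(2) by (intro image_eqI[of _ _ "(r, (y - r) / \<pi>)"]) simp_all
  qed
  moreover have "?g ` (T \<times> int_ring v) = T \<times> cls n ` int_ring v" by auto
  moreover have "card (?f ` (T \<times> int_ring v)) = card (?g ` (T \<times> int_ring v))"
  proof (rule card_image_cong_kernel, clarify)
    fix r x r' x'
    assume A: "r \<in> T" "x \<in> int_ring v" "r' \<in> T" "x' \<in> int_ring v"
    have eq: "r + \<pi> * x - (r' + \<pi> * x') = (r - r') + \<pi> * (x - x')" by (simp add: algebra_simps)
    have xx: "v (x - x') \<le> 1" using A by (auto simp: int_ring_def intro: diff_le)
    \<comment> \<open>Modulo \<pi> the term \<open>\<pi> * (x - x')\<close> disappears, so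
      \<open>r\<close> and \<open>r'\<close> represent the same residue and coincide.\<close>
    have "r = r'" if "v ((r - r') + \<pi> * (x - x')) \<le> v \<pi> ^ Suc n"
    proof -
      have "v \<pi> ^ Suc n \<le> v \<pi>" using uniformizer_pos uniformizer_less_1
        by (simp add: mult_left_le power_le_one)
      moreover have "v (\<pi> * (x - x')) \<le> v \<pi>"
        using mult_le[OF xx order_refl] by (simp add: mult.commute)
      ultimately have "v (r - r') \<le> v \<pi> ^ 1"
        using that diff_le[of "(r - r') + \<pi> * (x - x')" "v \<pi>" "\<pi> * (x - x')"] by simp
      then show ?thesis using T(2) A by (simp only: cls_eq_iff[symmetric] inj_on_eq_iff)
    qed
    moreover have "v ((r - r) + \<pi> * (x - x')) \<le> v \<pi> ^ Suc n \<longleftrightarrow> v (x - x') \<le> v \<pi> ^ n"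
      using uniformizer_pos by (simp add: mult)
    ultimately have "v ((r - r') + \<pi> * (x - x')) \<le> v \<pi> ^ Suc n \<longleftrightarrow>
        r = r' \<and> v (x - x') \<le> v \<pi> ^ n" by metis
    then show "cls (Suc n) (r + \<pi> * x) = cls (Suc n) (r' + \<pi> * x') \<longleftrightarrow>
               (r, cls n x) = (r', cls n x')"
      by (simp only: cls_eq_iff eq prod.inject)
  qed
  ultimately show ?case using Suc cardT by (simp add: card_cartesian_product)
qed

text \<open>The substitution \<open>a + \<pi> ^ n * y\<close> maps the integers onto the ball and
  turns congruence modulo \<open>\<pi> ^ (n + k)\<close> into congruence modulo
  \<open>\<pi> ^ k\<close>.\<close>

lemma card_cls_ball: "card (cls (n + k) ` {x. v (x - a) \<le> v \<pi> ^ n}) = residue_norm v ^ k"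
proof -
  have "{x. v (x - a) \<le> v \<pi> ^ n} = (\<lambda>y. a + \<pi> ^ n * y) ` int_ring v"
  proof (intro equalityI subsetI)
    fix x assume "x \<in> {x. v (x - a) \<le> v \<pi> ^ n}"
    then have "(x - a) / \<pi> ^ n \<in> int_ring v"
      using uniformizer_pos by (simp add: int_ring_def divide power)
    moreover have "x = a + \<pi> ^ n * ((x - a) / \<pi> ^ n)" using nonzero by simp
    ultimately show "x \<in> (\<lambda>y. a + \<pi> ^ n * y) ` int_ring v" by blast
  next
    fix x assume "x \<in> (\<lambda>y. a + \<pi> ^ n * y) ` int_ring v"
    then show "x \<in> {x. v (x - a) \<le> v \<pi> ^ n}"
      using uniformizer_pos by (auto simp: int_ring_def mult power mult_left_le)
  qed
  then have "card (cls (n + k) ` {x. v (x - a) \<le> v \<pi> ^ n}) =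
             card ((\<lambda>y. cls (n + k) (a + \<pi> ^ n * y)) ` int_ring v)"
    by (simp add: image_image)
  also have "\<dots> = card (cls k ` int_ring v)"
  proof (rule card_image_cong_kernel)
    fix x y
    have "a + \<pi> ^ n * x - (a + \<pi> ^ n * y) = \<pi> ^ n * (x - y)" by (simp add: algebra_simps)
    then show "cls (n + k) (a + \<pi> ^ n * x) = cls (n + k) (a + \<pi> ^ n * y) \<longleftrightarrow> cls k x = cls k y"
      using uniformizer_pos
      by (simp add: cls_eq_iff mult power power_add del: of_nat_add)
  qed
  finally show ?thesis by (simp add: card_cls_int_ring)
qed

text \<open>By discreteness the integers split into the units and the ball of radius
  \<open>v \<pi>\<close> around 0. Since the exponent \<open>Suc k\<close> is at least 1, no residue
  class meets both parts, so the two counts add up.\<close>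

lemma card_cls_units:
  assumes "finite (cls 1 ` int_ring v)"
  shows "card (cls (Suc k) ` {x. v x = 1}) = residue_norm v ^ Suc k - residue_norm v ^ k"
proof -
  have 1: "int_ring v = {x. v x = 1} \<union> {x. v (x - 0) \<le> v \<pi> ^ 1}"
    using less_1_iff by (auto simp: int_ring_def le_less)
  \<comment> \<open>As \<open>card\<close> is 0 on infinite sets, a positive cardinality proves
    finiteness.\<close>
  have fin: "finite (cls (Suc k) ` int_ring v)"
  proof (rule card_ge_0_finite)
    show "0 < card (cls (Suc k) ` int_ring v)"
      unfolding card_cls_int_ring using residue_norm_pos[OF assms] by simp
  qed
  have disj: "cls (Suc k) ` {x. v x = 1} \<inter> cls (Suc k) ` {x. v (x - 0) \<le> v \<pi> ^ 1} = {}"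
  proof -
    have "cls (Suc k) x \<noteq> cls (Suc k) y" if "v x = 1" "v y \<le> v \<pi>" for x y
    proof
      assume "cls (Suc k) x = cls (Suc k) y"
      moreover have "v \<pi> ^ Suc k < 1" using uniformizer_pos uniformizer_less_1
        by (intro power_Suc_less_one) auto
      ultimately have "v (x - y) < 1" by (simp only: cls_eq_iff)
      moreover have "v y < 1" using that less_1_iff by blast
      ultimately have "v x < 1" using add_less[of "x - y" 1 y] by simp
      then show False using that by simp
    qed
    then show ?thesis by fastforce
  qed
  have "card (cls (Suc k) ` int_ring v) = card (cls (Suc k) ` {x. v x = 1}) +
        card (cls (1 + k) ` {x. v (x - 0) \<le> v \<pi> ^ 1})"
    using fin unfolding 1 image_Un by (simp add: card_Un_disjoint[OF _ _ disj, simplified])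
  then show ?thesis by (simp only: card_cls_ball card_cls_int_ring)
qed

section \<open>The special orthogonal group of the hyperbolic plane modulo powers of \<pi>\<close>

lemma O_plus_hyperbolic:
  fixes s :: "'k^2"
  assumes two: "v 2 = 1"
    and s: "v (s$1) \<le> 1" "v (s$2) \<le> 1" "v (s$1) = 1 \<or> v (s$2) = 1"
    and t: "0 < t" "n \<le> t"
  defines "G \<equiv> vector [vector [0, 1], vector [1, 0]]"
  shows "O_plus v \<pi> 0 G s (int n) t =
    (\<lambda>u. mat_residue (ideal_pow v \<pi> (int t)) (vector [vector [u, 0], vector [0, inverse u]])) `
      {u. v u = 1 \<and> v (u - 1) \<le> v \<pi> ^ n}" (is "?L = ?d ` ?U")
proof (intro equalityI subsetI)
  \<comment> \<open>The first bound lets a congruence to 1 modulo \<open>\<pi> ^ t\<close> detect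
    units; the second lets congruences modulo \<open>\<pi> ^ t\<close> be read modulo
    \<open>\<pi> ^ n\<close>.\<close>
  have lt: "v \<pi> ^ t < 1"
    using t(1) uniformizer_pos uniformizer_less_1 by (simp add: power_less_one_iff)
  have le: "v \<pi> ^ t \<le> v \<pi> ^ n"
    using t(2) uniformizer_pos uniformizer_less_1 by (simp add: power_decreasing)
  note simps = mat_cong_def vec_cong_def int_matrices_def matrix_matrix_mult_def
    matrix_vector_mult_def transpose_def det_2 sum_2 forall_2 mem_ideal_pow mat_def int_ring_def
  show "z \<in> ?d ` ?U" if "z \<in> ?L" for z
  proof -
    obtain M where M: "z = mat_residue (ideal_pow v \<pi> (int t)) M" "M \<in> int_matrices v"
      "mat_cong (ideal_pow v \<pi> (int t)) (transpose M ** G ** M) G"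
      "det M - 1 \<in> ideal_pow v \<pi> (int t)" "vec_cong (ideal_pow v \<pi> (int n)) (M *v s) s"
      using \<open>z \<in> ?L\<close> by (auto simp: O_plus_def GL2_lifts_def)
    define a b c d where abcd: "a = M$1$1" "b = M$1$2" "c = M$2$1" "d = M$2$2"
    have int: "v a \<le> 1" "v b \<le> 1" "v c \<le> 1" "v d \<le> 1"
      using M(2) by (auto simp: abcd simps)
    have gram: "v (c * a + a * c) \<le> v \<pi> ^ t" "v (d * b + b * d) \<le> v \<pi> ^ t"
      "v (c * b + a * d - 1) \<le> v \<pi> ^ t"
      using M(3) by (simp_all add: abcd G_def simps)
    have "c * a + a * c = 2 * (a * c)" "d * b + b * d = 2 * (b * d)" by (simp_all add: algebra_simps)
    with gram have ac: "v (2 * (a * c)) \<le> v \<pi> ^ t" and bd: "v (2 * (b * d)) \<le> v \<pi> ^ t"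
      by simp_all
    have det: "v (a * d - b * c - 1) \<le> v \<pi> ^ t"
      using M(4) by (simp add: abcd simps)
    have sa: "v (a * s$1 + b * s$2 - s$1) \<le> v \<pi> ^ n"
      and sd: "v (c * s$1 + d * s$2 - s$2) \<le> v \<pi> ^ n"
      using M(5) by (simp_all add: abcd simps)
    \<comment> \<open>Adding the determinant to the off-diagonal Gram entry cancels
      \<open>b * c\<close>. So \<open>a * d\<close> is congruent to 1, \<open>a\<close> and
      \<open>d\<close> are units, and the diagonal Gram entries \<open>2 * (a * c)\<close> and
      \<open>2 * (b * d)\<close> force \<open>c\<close> and \<open>b\<close> to vanish modulo
      \<open>\<pi> ^ t\<close>.\<close>
    have "c * b + a * d - 1 + (a * d - b * c - 1) = 2 * (a * d - 1)" by (simp add: algebra_simps)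
    with add_le[OF gram(3) det] have "v (2 * (a * d - 1)) \<le> v \<pi> ^ t" by simp
    then have ad: "v (a * d - 1) \<le> v \<pi> ^ t" unfolding mult using two by simp
    then have "v (a * d) = 1" using lt eq_1_if_close[of "a * d" 1] by simp
    then have a1: "v a = 1" and d1: "v d = 1"
      using int mult_left_le[of "v d" "v a"] mult_left_le[of "v a" "v d"] nonneg[of a] nonneg[of d]
      by (simp_all add: mult mult.commute)
    have b: "v b \<le> v \<pi> ^ t" and c: "v c \<le> v \<pi> ^ t"
      using ac bd two a1 d1 by (simp_all add: mult)
    have "a \<noteq> 0" using a1 by auto
    then have "d - inverse a = (a * d - 1) / a" by (simp add: field_simps)
    then have da: "v (d - inverse a) \<le> v \<pi> ^ t" using ad a1 by (simp add: divide)
    \<comment> \<open>The unit coordinate of \<open>s\<close> can be cancelled in its row. The first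
      row gives the congruence for \<open>a\<close> directly; the second gives it for
      \<open>d\<close>, and it passes to \<open>a\<close> because \<open>d\<close> is congruent to
      \<open>inverse a\<close>.\<close>
    have "v (a - 1) \<le> v \<pi> ^ n"
      using s(3)
    proof
      assume "v (s$1) = 1"
      have "v (b * s$2) \<le> v \<pi> ^ n" using mult_le[OF s(2) b] le by (simp add: mult.commute)
      from diff_le[OF sa this] have "v ((a - 1) * s$1) \<le> v \<pi> ^ n" by (simp add: algebra_simps)
      then show ?thesis using \<open>v (s$1) = 1\<close> by (simp add: mult)
    next
      assume "v (s$2) = 1"
      have "v (c * s$1) \<le> v \<pi> ^ n" using mult_le[OF s(1) c] le by (simp add: mult.commute)
      from diff_le[OF sd this] have "v ((d - 1) * s$2) \<le> v \<pi> ^ n" by (simp add: algebra_simps)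
      then have "v (d - 1) \<le> v \<pi> ^ n" using \<open>v (s$2) = 1\<close> by (simp add: mult)
      then have "v (inverse a - inverse 1) \<le> v \<pi> ^ n"
        using da le diff_le[of "d - 1" "v \<pi> ^ n" "d - inverse a"] by simp
      then show ?thesis using inverse_close[of a 1] a1 by simp
    qed
    moreover have "z = ?d a"
      using b c da uniformizer_pos
      by (simp add: M(1) mat_residue_def vec_eq_iff forall_2 cls_def[symmetric] cls_eq_iff abcd)
    ultimately show ?thesis using a1 by blast
  qed
  show "z \<in> ?L" if "z \<in> ?d ` ?U" for z
  proof -
    obtain u where u: "v u = 1" "v (u - 1) \<le> v \<pi> ^ n" "z = ?d u" using \<open>z \<in> ?d ` ?U\<close> by blast
    \<comment> \<open>\<open>N\<close> is the exact inverse of \<open>M\<close>. All required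
      congruences hold as equalities, except the one on \<open>s\<close>, which comes from
      \<open>u\<close> and its inverse being congruent to 1 modulo \<open>\<pi> ^ n\<close>.\<close>
    define M N :: "'k^2^2" where "M = vector [vector [u, 0], vector [0, inverse u]]"
      and "N = vector [vector [inverse u, 0], vector [0, u]]"
    have u0: "u \<noteq> 0" using u by auto
    have iu: "v (inverse u - 1) \<le> v \<pi> ^ n" using inverse_close[of u 1] u by simp
    have "M \<in> int_matrices v" "N \<in> int_matrices v"
      using u by (simp_all add: M_def N_def simps inverse)
    moreover have "mat_cong (ideal_pow v \<pi> (int t)) (M ** N) (mat 1)"
      "mat_cong (ideal_pow v \<pi> (int t)) (N ** M) (mat 1)"
      "mat_cong (ideal_pow v \<pi> (int t)) (transpose M ** G ** M) G"
      "det M - 1 \<in> ideal_pow v \<pi> (int t)"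
      using u0 uniformizer_pos by (simp_all add: M_def N_def G_def simps)
    moreover have "vec_cong (ideal_pow v \<pi> (int n)) (M *v s) s"
    proof -
      have "v ((u - 1) * s$1) \<le> v \<pi> ^ n" "v ((inverse u - 1) * s$2) \<le> v \<pi> ^ n"
        using mult_le[OF s(1) u(2)] mult_le[OF s(2) iu] by (simp_all add: mult.commute)
      then show ?thesis by (simp add: M_def simps algebra_simps)
    qed
    ultimately show ?thesis
      unfolding O_plus_def GL2_lifts_def u(3) M_def[symmetric] by auto
  qed
qed

text \<open>The class of a unit determines the class of its inverse, so the diagonal matrices are
  counted by their first entry alone.\<close>

lemma card_O_plus_hyperbolic:
  fixes s :: "'k^2"
  assumes "v 2 = 1"
    and "v (s$1) \<le> 1" "v (s$2) \<le> 1" "v (s$1) = 1 \<or> v (s$2) = 1"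
    and "0 < t" "n \<le> t"
  shows "card (O_plus v \<pi> 0 (vector [vector [0, 1], vector [1, 0]]) s (int n) t) =
    card (cls t ` {u. v u = 1 \<and> v (u - 1) \<le> v \<pi> ^ n})"
  unfolding O_plus_hyperbolic[OF assms]
proof (rule card_image_cong_kernel)
  fix x y assume "x \<in> {u. v u = 1 \<and> v (u - 1) \<le> v \<pi> ^ n}" "y \<in> {u. v u = 1 \<and> v (u - 1) \<le> v \<pi> ^ n}"
  then show "mat_residue (ideal_pow v \<pi> (int t)) (vector [vector [x, 0], vector [0, inverse x]]) =
      mat_residue (ideal_pow v \<pi> (int t)) (vector [vector [y, 0], vector [0, inverse y]]) \<longleftrightarrow>
    cls t x = cls t y"
    using uniformizer_pos
    by (auto simp: mat_residue_def vec_eq_iff forall_2 cls_def[symmetric] cls_eq_iff inverse_close)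
qed

end

section \<open>Finiteness of the residue field\<close>

context padic_numbers
begin

lemma abs_of_int_eq: "z \<noteq> 0 \<Longrightarrow> w (of_int z) = inverse (real p ^ multiplicity (int p) z)"
  using abs_of_rat[of "of_int z"] by (simp add: padic_abs_def power_int_minus)

lemma abs_of_int_less_1: "w (of_int z) < 1 \<longleftrightarrow> int p dvd z"
proof (cases "z = 0")
  case False
  have p: "1 < p" using prime_p by (rule prime_gt_1_nat)
  have "multiplicity (int p) z = 0 \<longleftrightarrow> \<not> int p dvd z"
    using False p by (subst multiplicity_eq_zero_iff) auto
  then show ?thesis
    using False p
    by (cases "multiplicity (int p) z")
      (auto simp: abs_of_int_eq inverse_less_1_iff simp del: power_Suc)
qed simp

lemma abs_of_int_le_1: "w (of_int z) \<le> 1"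
proof (cases "z = 0")
  case False
  then show ?thesis
    using prime_gt_1_nat[OF prime_p]
    by (simp add: abs_of_int_eq inverse_le_1_iff)
qed simp

text \<open>By density \<open>c\<close> is congruent to a rational \<open>a / b\<close> in lowest
  terms. As \<open>c\<close> is integral, \<open>p\<close> does not divide \<open>b\<close>, and
  \<open>k\<close> is the remainder of \<open>a * y\<close> modulo \<open>p\<close>, where
  \<open>y\<close> is a Bezout inverse of \<open>b\<close>.\<close>

lemma ex_nat_residue:
  assumes "w c \<le> 1"
  shows "\<exists>k<p. w (c - of_nat k) < 1"
proof -
  have p: "1 < p" using prime_p by (rule prime_gt_1_nat)
  obtain r where r: "w (c - of_rat r) < 1" using dense[of 1] by auto
  obtain a b where ab: "quotient_of r = (a, b)" by fastforce
  have b0: "0 < b" and cop: "coprime a b" and rab: "r = of_int a / of_int b"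
    using ab quotient_of_denom_pos quotient_of_coprime quotient_of_div by blast+
  have rq: "(of_rat r :: 'q) = of_int a / of_int b" using rab by (simp add: of_rat_divide)
  have wr: "w (of_rat r) \<le> 1"
    using diff_le[of c 1 "c - of_rat r"] assms r by simp
  have "\<not> int p dvd b"
  proof
    assume "int p dvd b"
    then have "\<not> int p dvd a"
      using cop p coprime_common_divisor[of a b "int p"] by auto
    then have "w (of_int a) = 1" using abs_of_int_less_1[of a] abs_of_int_le_1[of a] by simp
    moreover have "w (of_int b) < 1" "0 < w (of_int b)"
      using \<open>int p dvd b\<close> abs_of_int_less_1 b0 by (auto intro: pos)
    ultimately show False using wr unfolding rq divide by simp
  qed
  then have wb: "w (of_int b) = 1" using abs_of_int_less_1[of b] abs_of_int_le_1[of b] by simp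
  have "gcd b (int p) = 1"
    using \<open>\<not> int p dvd b\<close> prime_p prime_imp_coprime[of "int p" b]
    by (simp add: coprime_commute flip: coprime_iff_gcd_eq_1)
  then obtain y u where yu: "y * b + u * int p = 1" using bezout_int[of b "int p"] by auto
  define k where "k = nat ((a * y) mod int p)"
  have k: "int k = (a * y) mod int p" using p by (simp add: k_def)
  \<comment> \<open>Inserting \<open>1 = y * b + u * int p\<close> and writing the remainder as
    \<open>a * y\<close> minus a multiple of \<open>p\<close> makes the factor \<open>p\<close>
    visible.\<close>
  have "a - b * int k = a * (y * b + u * int p) - b * (a * y - int p * (a * y div int p))"
    unfolding k minus_mult_div_eq_mod yu by simp
  then have "a - b * int k = int p * (a * u + b * (a * y div int p))"
    by (simp add: algebra_simps)
  then have "int p dvd a - b * int k" by simp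
  then have "w (of_int (a - b * int k)) < 1" by (simp only: abs_of_int_less_1)
  moreover have "of_rat r - of_nat k = of_int (a - b * int k) / (of_int b :: 'q)"
    using b0 by (simp add: rq field_simps)
  ultimately have "w (of_rat r - of_nat k) < 1" using wb by (simp add: divide del: of_int_diff)
  then have "w (c - of_nat k) < 1" using add_less[OF r] by force
  moreover have "int k < int p" unfolding k using p by (intro pos_mod_bound) simp
  then have "k < p" by simp
  ultimately show ?thesis by blast
qed

end

section \<open>Residual independence and the degree of the extension\<close>

context padic_extension
begin

lemma embed_0: "\<iota> 0 = 0"
  by (metis add.right_neutral add_left_cancel embed_add)

lemma embed_of_nat: "\<iota> (of_nat n) = of_nat n"
  by (induction n) (simp_all add: embed_0 embed_1 embed_add)

lemma embed_minus: "\<iota> (- x) = - \<iota> x"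
  using embed_add[of x "- x"] embed_0 by (simp add: eq_neg_iff_add_eq_0 add.commute)

lemma embed_diff: "\<iota> (x - y) = \<iota> x - \<iota> y"
  using embed_add[of x "- y"] embed_minus by simp

lemma abs_of_nat_less_1: "v (of_nat n) < 1 \<longleftrightarrow> p dvd n"
  using Qp.abs_of_int_less_1[of "int n"] abs_embed[of "of_nat n"] by (simp add: embed_of_nat)

lemma abs_of_nat_le_1: "v (of_nat n) \<le> 1"
  using Qp.abs_of_int_le_1[of "int n"] abs_embed[of "of_nat n"] by (simp add: embed_of_nat)

text \<open>Linear independence over the prime field after reduction modulo the maximal ideal.\<close>

definition residually_independent :: "'k set \<Rightarrow> bool" where
  "residually_independent S \<longleftrightarrow> finite S \<and> S \<subseteq> int_ring v \<and>
     (\<forall>c. (\<forall>x\<in>S. w (c x) \<le> 1) \<and> v (\<Sum>x\<in>S. \<iota> (c x) * x) < 1 \<longrightarrow> (\<forall>x\<in>S. w (c x) < 1))"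

text \<open>A nontrivial linear relation over the p-adic numbers, divided by a coefficient of
  largest absolute value, has integral coefficients one of which is 1. This contradicts residual
  independence, so \<open>S\<close> is linearly independent and no larger than a basis.\<close>

lemma residually_independent_card_bound:
  "\<exists>n. \<forall>S. residually_independent S \<longrightarrow> card S \<le> n"
proof -
  obtain Bs where "finite_dimensional_vector_space (\<lambda>a x. \<iota> a * x) Bs"
    using finite_degree by blast
  then interpret K: finite_dimensional_vector_space "\<lambda>a x. \<iota> a * x" Bs .
  have "card S \<le> card Bs" if S: "residually_independent S" for S
  proof -
    have fin: "finite S" using S by (simp add: residually_independent_def)
    have "\<not> K.dependent S"
    proof
      assume "K.dependent S"
      then obtain c y where c: "y \<in> S" "c y \<noteq> 0" "(\<Sum>x\<in>S. \<iota> (c x) * x) = 0"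
        using K.dependent_finite[OF fin] by blast
      have "Max ((\<lambda>x. w (c x)) ` S) \<in> (\<lambda>x. w (c x)) ` S"
        using fin c(1) by (intro Max_in) auto
      then obtain z where "z \<in> S" "w (c z) = Max ((\<lambda>x. w (c x)) ` S)" by auto
      then have z: "z \<in> S" "\<And>x. x \<in> S \<Longrightarrow> w (c x) \<le> w (c z)" using fin by simp_all
      have wz: "0 < w (c z)" using Qp.pos[OF c(2)] z(2)[OF c(1)] by linarith
      have "(\<Sum>x\<in>S. \<iota> (c x / c z) * x) = \<iota> (inverse (c z)) * (\<Sum>x\<in>S. \<iota> (c x) * x)"
        by (simp add: sum_distrib_left divide_inverse embed_mult ac_simps)
      then have "v (\<Sum>x\<in>S. \<iota> (c x / c z) * x) < 1" using c(3) by simp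
      moreover have "\<forall>x\<in>S. w (c x / c z) \<le> 1"
        using z(2) wz by (simp add: Qp.divide)
      ultimately have "w (c z / c z) < 1"
        using S z(1) unfolding residually_independent_def
        by (elim conjE allE[of _ "\<lambda>x. c x / c z"]) blast
      then show False unfolding Qp.divide using wz by simp
    qed
    then show ?thesis
      using K.independent_span_bound[OF K.finite_Basis] K.span_Basis by blast
  qed
  then show ?thesis by blast
qed

text \<open>A residually independent set \<open>S\<close> of maximal size spans the residue field:
  every integer is congruent to a combination of \<open>S\<close> with coefficients below
  \<open>p\<close>, and there are finitely many of these.\<close>

lemma finite_residue_field: "finite (residue_class (max_ideal v) ` int_ring v)"
proof -
  obtain n where n: "\<And>S. residually_independent S \<Longrightarrow> card S < n"
    using residually_independent_card_bound by (metis less_Suc_eq_le)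
  have "residually_independent {}" by (simp add: residually_independent_def)
  then obtain S where S: "residually_independent S"
    and max: "\<And>S'. residually_independent S' \<Longrightarrow> card S' \<le> card S"
    using ex_has_greatest_nat[of residually_independent "{}" card n] n less_imp_le by blast
  have fin: "finite S" and SO: "\<And>x. x \<in> S \<Longrightarrow> v x \<le> 1"
    and ind: "\<And>c. \<lbrakk>\<And>x. x \<in> S \<Longrightarrow> w (c x) \<le> 1; v (\<Sum>x\<in>S. \<iota> (c x) * x) < 1\<rbrakk>
              \<Longrightarrow> \<forall>x\<in>S. w (c x) < 1"
    using S by (auto simp: residually_independent_def int_ring_def)
  have comb: "\<exists>d. (\<forall>x\<in>S. w (d x) \<le> 1) \<and> v (y - (\<Sum>x\<in>S. \<iota> (d x) * x)) < 1" if y: "v y \<le> 1" for y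
  proof (cases "y \<in> S")
    case True
    have "(\<Sum>x\<in>S. \<iota> (if x = y then 1 else 0) * x) = (\<Sum>x\<in>S. if x = y then x else 0)"
      by (intro sum.cong) (simp_all add: embed_0 embed_1)
    then have "(\<Sum>x\<in>S. \<iota> (if x = y then 1 else 0) * x) = y"
      using True fin by simp
    then show ?thesis by (intro exI[of _ "\<lambda>x. if x = y then 1 else 0"]) simp
  next
    case False
    then have "\<not> residually_independent (insert y S)"
      using max[of "insert y S"] fin by auto
    then obtain c z where c: "\<And>x. x \<in> insert y S \<Longrightarrow> w (c x) \<le> 1"
      "v (\<iota> (c y) * y + (\<Sum>x\<in>S. \<iota> (c x) * x)) < 1" "z \<in> insert y S" "\<not> w (c z) < 1"
      using fin False y SO unfolding residually_independent_def by (auto simp: int_ring_def)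
    \<comment> \<open>If the coefficient of \<open>y\<close> were not a unit, its term would drop
      out of the congruence, leaving a relation on \<open>S\<close> that contradicts the
      independence of \<open>S\<close>.\<close>
    have cy: "w (c y) = 1"
    proof (rule ccontr)
      assume "w (c y) \<noteq> 1"
      then have cy: "w (c y) < 1" using c(1)[of y] by simp
      have "v (\<iota> (c y) * y) < 1"
        using cy mult_le[OF y, of "\<iota> (c y)" "w (c y)"] by (simp add: abs_embed mult.commute)
      from diff_less[OF c(2) this] have "v (\<Sum>x\<in>S. \<iota> (c x) * x) < 1" by simp
      then have "\<forall>x\<in>S. w (c x) < 1" using c(1) by (intro ind) auto
      then show False using cy c(3,4) by blast
    qed
    define d where "d x = - (c x / c y)" for x
    have "c y \<noteq> 0" using cy by auto
    then have "\<iota> (c y) * \<iota> (inverse (c y)) = 1"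
      using embed_mult[of "c y" "inverse (c y)"] embed_1 by simp
    then have "y - (\<Sum>x\<in>S. \<iota> (d x) * x)
        = \<iota> (inverse (c y)) * (\<iota> (c y) * y + (\<Sum>x\<in>S. \<iota> (c x) * x))"
      by (simp add: d_def embed_minus divide_inverse embed_mult sum_negf sum_distrib_left
          algebra_simps)
    moreover have "v (\<iota> (inverse (c y))) = 1" using cy by (simp add: abs_embed Qp.inverse)
    ultimately have "v (y - (\<Sum>x\<in>S. \<iota> (d x) * x)) < 1" using c(2) by (simp add: mult)
    moreover have "\<forall>x\<in>S. w (d x) \<le> 1" using c(1) cy by (simp add: d_def Qp.divide)
    ultimately show ?thesis by blast
  qed
  \<comment> \<open>Each coefficient is replaced by a natural number below \<open>p\<close> in its
    residue class. Taking \<open>f\<close> extensional keeps the set of choices finite.\<close>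
  have "\<exists>f\<in>S \<rightarrow>\<^sub>E {..<p}. v (y - (\<Sum>x\<in>S. of_nat (f x) * x)) < 1" if y: "v y \<le> 1" for y
  proof -
    obtain d where d: "\<And>x. x \<in> S \<Longrightarrow> w (d x) \<le> 1" "v (y - (\<Sum>x\<in>S. \<iota> (d x) * x)) < 1"
      using comb[OF y] by blast
    obtain f where f: "\<And>x. x \<in> S \<Longrightarrow> f x < p \<and> w (d x - of_nat (f x)) < 1"
      using Qp.ex_nat_residue[OF d(1)] by metis
    have "v (\<Sum>x\<in>S. \<iota> (d x - of_nat (f x)) * x) < 1"
    proof (rule sum_less)
      fix x assume "x \<in> S"
      then show "v (\<iota> (d x - of_nat (f x)) * x) < 1"
        using f[of x] mult_le[OF SO[of x] order_refl, of "\<iota> (d x - of_nat (f x))"]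
        by (simp add: abs_embed mult.commute)
    qed simp
    from add_less[OF d(2) this] have "v (y - (\<Sum>x\<in>S. of_nat (f x) * x)) < 1"
      by (simp add: embed_diff embed_of_nat left_diff_distrib sum_subtractf)
    then show ?thesis
      using f by (intro bexI[of _ "restrict f S"]) (auto cong: sum.cong)
  qed
  moreover have "residue_class (max_ideal v) y = residue_class (max_ideal v) z"
    if "v (y - z) < 1" for y z
  proof -
    have "v (x - y) < 1 \<longleftrightarrow> v (x - z) < 1" for x
      using that add_less[of "x - y" 1 "y - z"] diff_less[of "x - z" 1 "y - z"] by auto
    then show ?thesis by (simp add: residue_class_def max_ideal_def)
  qed
  ultimately have "residue_class (max_ideal v) ` int_ring v \<subseteq>
      (\<lambda>f. residue_class (max_ideal v) (\<Sum>x\<in>S. of_nat (f x) * x)) ` (S \<rightarrow>\<^sub>E {..<p})"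
    by (fastforce simp: int_ring_def)
  moreover have "finite (S \<rightarrow>\<^sub>E {..<p})" using fin by (intro finite_PiE) auto
  ultimately show ?thesis by (rule finite_subset[OF _ finite_imageI])
qed

end

section \<open>The local density as an eventually constant quotient\<close>

theorem theorem3p5:
  fixes p :: nat
    and w :: "'q::field_char_0 \<Rightarrow> real" and \<iota> :: "'q \<Rightarrow> 'k::field" and v :: "'k \<Rightarrow> real"
    and \<pi> :: 'k
    and smul :: "'k \<Rightarrow> 'v::ab_group_add \<Rightarrow> 'v"
    and B :: "'v \<Rightarrow> 'v \<Rightarrow> 'k" and e\<^sub>1 e\<^sub>2 :: 'v
    and s :: "'k^2" and m :: int and X :: "'v set"
  assumes "padic_extension p w \<iota> v"
    and "odd p"
    and "uniformizer v \<pi>"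
    and "quadratic_plane smul B e\<^sub>1 e\<^sub>2"
    and "gram B e\<^sub>1 e\<^sub>2 = vector [vector [0, 1], vector [1, 0]]"
    and "lattice_coset v \<pi> smul e\<^sub>1 e\<^sub>2 s m X"
  shows "(m = 0 \<longrightarrow> has_beta_plus v \<pi> 0 (gram B e\<^sub>1 e\<^sub>2) s m (1 - 1 / real (residue_norm v))) \<and>
         (m \<ge> 1 \<longrightarrow> has_beta_plus v \<pi> 0 (gram B e\<^sub>1 e\<^sub>2) s m (real (residue_norm v) powi (- m)))"
proof -
  interpret padic_extension p w \<iota> v by fact
  \<comment> \<open>The prime \<open>p\<close> is a nonzero element of the maximal ideal, so the
    generator \<pi> cannot be 0.\<close>
  have "0 < v (of_nat p)" "v (of_nat p) < 1"
    using abs_of_nat_less_1[of p] abs_embed[of "of_nat p"] Qp.pos[of "of_nat p"] Qp.prime_p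
    by (auto simp: embed_of_nat)
  moreover from this have "of_nat p \<in> {\<pi> * x |x. x \<in> int_ring v}"
    using assms(3) unfolding uniformizer_def max_ideal_def by blast
  ultimately have "\<pi> \<noteq> 0" by auto
  then interpret D: discrete_abs v \<pi>
    by unfold_locales (use assms(3) in auto)
  let ?q = "residue_norm v"
  have fin: "finite (D.cls 1 ` int_ring v)"
    using finite_residue_field by (simp only: D.max_ideal_eq D.cls_def)
  then have q0: "?q > 0" by (rule D.residue_norm_pos)
  have "\<not> p dvd 2"
    using assms(2) primes_dvd_imp_eq[OF Qp.prime_p two_is_prime_nat] by auto
  then have two: "v 2 = 1"
    using abs_of_nat_less_1[of 2] abs_of_nat_le_1[of 2] by simp
  have "\<forall>i. v (s$i) \<le> 1" "\<exists>i. v (s$i) = 1"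
    using assms(6) by (auto simp: lattice_coset_def int_ring_def max_ideal_def not_less
        intro: antisym)
  then have s: "v (s$1) \<le> 1" "v (s$2) \<le> 1" "v (s$1) = 1 \<or> v (s$2) = 1"
    by (auto, metis exhaust_2)
  note card = D.card_O_plus_hyperbolic[OF two s]
  show ?thesis
  proof (intro conjI impI)
    assume "m = 0"
    have "eventually (\<lambda>t. real (card (O_plus v \<pi> 0 (gram B e\<^sub>1 e\<^sub>2) s m t)) / real ?q ^ t =
        1 - 1 / real ?q) sequentially"
      using eventually_gt_at_top[of 0]
    proof eventually_elim
      case (elim t)
      then obtain k where t: "t = Suc k" by (cases t) auto
      \<comment> \<open>Congruence modulo \<open>\<pi> ^ 0\<close> imposes no condition on a
        unit.\<close>
      have "{u. v u = 1 \<and> v (u - 1) \<le> v \<pi> ^ 0} = {u. v u = 1}"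
        by (auto intro: diff_le)
      then have "card (O_plus v \<pi> 0 (gram B e\<^sub>1 e\<^sub>2) s m t) = card (D.cls (Suc k) ` {u. v u = 1})"
        using card[of t 0] elim by (simp add: assms(5) \<open>m = 0\<close> t)
      also have "\<dots> = ?q ^ Suc k - ?q ^ k" by (rule D.card_cls_units[OF fin])
      \<comment> \<open>The difference of natural numbers is not truncated because \<open>?q\<close>
        is positive.\<close>
      finally show ?case using q0 by (simp add: t field_simps)
    qed
    then show "has_beta_plus v \<pi> 0 (gram B e\<^sub>1 e\<^sub>2) s m (1 - 1 / real ?q)"
      unfolding has_beta_plus_def by (rule tendsto_eventually)
  next
    assume "1 \<le> m"
    then obtain n where n: "m = int n" "1 \<le> n" by (cases m) auto
    have "eventually (\<lambda>t. real (card (O_plus v \<pi> 0 (gram B e\<^sub>1 e\<^sub>2) s m t)) / real ?q ^ t =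
        real ?q powi (- m)) sequentially"
      using eventually_ge_at_top[of n]
    proof eventually_elim
      case (elim t)
      then obtain k where t: "t = n + k" by (metis le_iff_add)
      have "v \<pi> ^ n < 1"
        using n(2) D.uniformizer_pos D.uniformizer_less_1 by (simp add: power_less_one_iff)
      \<comment> \<open>For positive \<open>n\<close>, being congruent to 1 already makes
        \<open>u\<close> a unit, so the set is a full ball around 1.\<close>
      then have "{u. v u = 1 \<and> v (u - 1) \<le> v \<pi> ^ n} = {u. v (u - 1) \<le> v \<pi> ^ n}"
        using eq_1_if_close[of _ 1] by fastforce
      then have "card (O_plus v \<pi> 0 (gram B e\<^sub>1 e\<^sub>2) s m t) = ?q ^ k"
        using card[of t n] elim n by (simp add: assms(5) t D.card_cls_ball del: of_nat_add)
      then show ?case using q0 by (simp add: t n power_int_minus power_add field_simps)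
    qed
    then show "has_beta_plus v \<pi> 0 (gram B e\<^sub>1 e\<^sub>2) s m (real ?q powi (- m))"
      unfolding has_beta_plus_def by (rule tendsto_eventually)
  qed
qed

end
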